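(* Let $H^\infty$ be an infinite hallway admitting a line of sight and let $m$ be a positive integer. Then $H^\infty$ has period $m$ if and only if it admits a rational line of sight with slope $p/m$ for some $p\in\mathbb{Z}$.
   Context: Let $\mathbb{R}^\epsilon=\{a+b\epsilon:a,b\in\mathbb{R}\}$ be the two-dimensional real vector space with basis $\{1,\epsilon\}$, totally ordered by $a+b\epsilon<c+d\epsilon$ iff $a<c$, or $a=c$ and $b<d$; intervals in $\mathbb{R}^\epsilon$ are taken with respect to this order. An infinite hallway is a set $H^\infty=\bigcup_{i\ge 0}\{i\}\times(\mathbb{R}^\epsilon\setminus D_i)\subset\mathbb{R}\times\mathbb{R}^\epsilon$, where $D_i=(d_i,d_i+1)\subset\mathbb{R}^\epsilon$ with $d_i\in\mathbb{Z}$ for all integers $i\ge 0$ (the $i$th doorway). For $\alpha,\beta\in\mathbb{R}$ the infinite line of slope $\alpha$ is $\ell^\epsilon_{\alpha\beta}=\{(x,\alpha x+\beta+t\epsilon):x,t\in\mathbb{R}\}$. For $(x,y)\in\mathbb{R}\times\mathbb{R}^\epsilon$ let $\mathrm{proj}_\alpha(x,y)=y-\alpha x$. Define $\ell^\epsilon_{\alpha\beta}\vee H^\infty=\{a\in\mathbb{R}: a+b\epsilon\in \mathrm{proj}_\alpha(\ell^\epsilon_{\alpha\beta})\cap(\mathbb{R}^\epsilon\setminus\mathrm{proj}_\alpha(H^\infty))\text{ for some }b\in\mathbb{R}\}$. The infinite line $\ell^\epsilon_{\alpha\beta}$ is a line of sight for $H^\infty$ (and $H^\infty$ admits it) if $\ell^\epsilon_{\alpha\beta}\vee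 H^\infty\ne\emptyset$; it is a rational line of sight if moreover $\alpha\in\mathbb{Q}$. $H^\infty$ has period $m>0$ (is periodic with period $m$) if there is $k\in\mathbb{Z}$ such that $D_{i+m}=D_i+k=(d_i+k,d_i+k+1)$ for all $i$. Here $m$ need not be the minimal period. *)

theory Defs
  imports "HOL-Analysis.Product_Vector" "HOL-Library.Product_Lexorder"
begin

text \<open>
  The ordered vector space of all \<open>a + b \<epsilon>\<close> is represented by pairs \<open>(a, b)\<close>: the vector space
  structure on pairs is the componentwise one, and the order is the lexicographic one of
  \<^theory>\<open>HOL-Library.Product_Lexorder\<close>, so that intervals have the required meaning.
\<close>

type_synonym real_eps = "real \<times> real"

definition std :: "real \<Rightarrow> real_eps"
  where "std a = (a, 0)"

definition eps :: real_eps
  where "eps = (0, 1)"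

lemma std_eps_eq: "std a + b *\<^sub>R eps = (a, b)"
  by (simp add: std_def eps_def)

lemma std_eps_less_iff:
  "std a + b *\<^sub>R eps < std c + d *\<^sub>R eps \<longleftrightarrow> a < c \<or> a = c \<and> b < d"
  by (auto simp: std_eps_eq)

definition doorway :: "int \<Rightarrow> real_eps set"
  where "doorway n = {std (of_int n) <..< std (of_int n + 1)}"

text \<open>An infinite hallway is given by the positions \<open>d i\<close> of its doorways \<open>doorway (d i)\<close>.\<close>

definition infinite_hallway :: "(nat \<Rightarrow> int) \<Rightarrow> (real \<times> real_eps) set"
  where "infinite_hallway d = (\<Union>i. {real i} \<times> (UNIV - doorway (d i)))"

definition infinite_line :: "real \<Rightarrow> real \<Rightarrow> (real \<times> real_eps) set"
  where "infinite_line \<alpha> \<beta> = {(x, std (\<alpha> * x + \<beta>) + t *\<^sub>R eps) | x t. True}"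

definition proj :: "real \<Rightarrow> real \<times> real_eps \<Rightarrow> real_eps"
  where "proj \<alpha> = (\<lambda>(x, y). y - std (\<alpha> * x))"

definition line_vee :: "real \<Rightarrow> real \<Rightarrow> (real \<times> real_eps) set \<Rightarrow> real set"
  where "line_vee \<alpha> \<beta> H =
    {a. \<exists>b. std a + b *\<^sub>R eps \<in> proj \<alpha> ` infinite_line \<alpha> \<beta> \<inter> (UNIV - proj \<alpha> ` H)}"

definition line_of_sight :: "real \<Rightarrow> real \<Rightarrow> (real \<times> real_eps) set \<Rightarrow> bool"
  where "line_of_sight \<alpha> \<beta> H \<longleftrightarrow> line_vee \<alpha> \<beta> H \<noteq> {}"

definition rational_line_of_sight :: "real \<Rightarrow> real \<Rightarrow> (real \<times> real_eps) set \<Rightarrow> bool"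
  where "rational_line_of_sight \<alpha> \<beta> H \<longleftrightarrow> line_of_sight \<alpha> \<beta> H \<and> \<alpha> \<in> \<rat>"

definition has_period :: "(nat \<Rightarrow> int) \<Rightarrow> nat \<Rightarrow> bool"
  where "has_period d m \<longleftrightarrow>
    m > 0 \<and> (\<exists>k::int. \<forall>i. doorway (d (i + m)) = (\<lambda>y. y + std (of_int k)) ` doorway (d i))"

end

theory Submission
  imports Defs
begin

text \<open>
  Projecting along the slope \<open>\<alpha>\<close> turns a line of sight into a single point: some line parallel to
  it, displaced by an infinitesimal \<open>b\<close>, passes through every doorway, so that
  \<open>(\<alpha> * i + \<beta>, b) \<in> doorway (d i)\<close> for all \<open>i\<close>, with the same \<open>b\<close> throughout (lemma
  \<open>line_of_sight_iff\<close>). Every point other than those of \<open>\<int> \<subseteq> \<real>\<^sup>\<epsilon>\<close> lies in exactly one doorway, hence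
  \<open>\<alpha>\<close>, \<open>\<beta>\<close> and \<open>b\<close> determine the hallway.

  If \<open>\<alpha> = p / m\<close>, moving \<open>m\<close> steps along the line raises it by the integer \<open>p\<close>, and so raises the
  unique doorway containing it by \<open>p\<close>: the hallway has period \<open>m\<close>. Conversely, the hallway follows
  the line up to a bounded error, so that its average slope is \<open>\<alpha>\<close>; if its doorways rise by \<open>k\<close>
  in every \<open>m\<close> steps, the average slope is also \<open>k / m\<close>. Therefore every line of sight of a
  hallway with period \<open>m\<close> has slope \<open>k / m\<close>, and the one assumed to exist is already as required.
\<close>

lemma mem_doorway_iff:
  "(x, b) \<in> doorway n \<longleftrightarrow>
     (of_int n < x \<or> x = of_int n \<and> 0 < b) \<and> (x < of_int n + 1 \<or> x = of_int n + 1 \<and> b < 0)"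
  by (auto simp: doorway_def std_def)

lemma doorway_unique:
  assumes "z \<in> doorway n" and "z \<in> doorway n'"
  shows "n = n'"
proof -
  obtain x b where z: "z = (x, b)" by (cases z)
  have False if "n < n'" "z \<in> doorway n" "z \<in> doorway n'" for n n'
  proof -
    from \<open>n < n'\<close> have "real_of_int n + 1 \<le> of_int n'" by linarith
    \<comment> \<open>Two doorways share a standard part only if they are neighbours, at \<open>x = n + 1 = n'\<close>,
        and there the lower one requires \<open>b < 0\<close> and the upper one \<open>0 < b\<close>.\<close>
    with that(2,3) show False by (auto simp: z mem_doorway_iff)
  qed
  with assms show ?thesis by (metis linorder_neqE)
qed

lemma doorway_translate: "(\<lambda>y. y + std (of_int k)) ` doorway n = doorway (n + k)"
proof (intro subset_antisym subsetI)
  fix z assume "z \<in> doorway (n + k)"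
  then have "z - std (of_int k) \<in> doorway n"
    by (cases z) (auto simp: std_def mem_doorway_iff)
  then show "z \<in> (\<lambda>y. y + std (of_int k)) ` doorway n"
    by (rule rev_image_eqI) simp
qed (auto simp: std_def mem_doorway_iff)

lemma doorway_inject [simp]: "doorway n = doorway n' \<longleftrightarrow> n = n'"
proof
  assume eq: "doorway n = doorway n'"
  have "(of_int n + 1 / 2, 0) \<in> doorway n" by (simp add: mem_doorway_iff)
  with eq show "n = n'" using doorway_unique by blast
qed simp

lemma has_period_iff: "has_period d m \<longleftrightarrow> m > 0 \<and> (\<exists>k. \<forall>i. d (i + m) = d i + k)"
  by (simp add: has_period_def doorway_translate)

text \<open>
  The projection of the line is the fibre over \<open>\<beta>\<close>, so only the infinitesimal part of a point
  outside the projected walls remains to be chosen; the point misses all the walls exactly when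
  its translates along the slope lie in all the doorways.
\<close>

lemma line_of_sight_iff:
  "line_of_sight \<alpha> \<beta> (infinite_hallway d) \<longleftrightarrow> (\<exists>b. \<forall>i. (\<alpha> * real i + \<beta>, b) \<in> doorway (d i))"
proof -
  have line: "(a, b) \<in> proj \<alpha> ` infinite_line \<alpha> \<beta> \<longleftrightarrow> a = \<beta>" for a b
    by (force simp: proj_def infinite_line_def std_def eps_def image_iff)
  have wall: "(a, b) \<in> proj \<alpha> ` infinite_hallway d \<longleftrightarrow>
      (\<exists>i. (\<alpha> * real i + a, b) \<notin> doorway (d i))" for a b
  proof
    assume "(a, b) \<in> proj \<alpha> ` infinite_hallway d"
    then obtain x y where "(a, b) = y - std (\<alpha> * x)" and xy: "(x, y) \<in> infinite_hallway d"
      by (auto simp: proj_def)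
    then have y: "y = (a, b) + std (\<alpha> * x)" by simp
    from xy obtain i where "x = real i" "y \<notin> doorway (d i)"
      by (auto simp: infinite_hallway_def)
    with y show "\<exists>i. (\<alpha> * real i + a, b) \<notin> doorway (d i)"
      by (auto simp: std_def add.commute)
  next
    assume "\<exists>i. (\<alpha> * real i + a, b) \<notin> doorway (d i)"
    then obtain i where "(\<alpha> * real i + a, b) \<notin> doorway (d i)" ..
    then have "(real i, (\<alpha> * real i + a, b)) \<in> infinite_hallway d"
      by (auto simp: infinite_hallway_def)
    then show "(a, b) \<in> proj \<alpha> ` infinite_hallway d"
      by (rule rev_image_eqI) (simp add: proj_def std_def)
  qed
  show ?thesis
    by (simp add: line_of_sight_def line_vee_def std_eps_eq line wall)
qed

text \<open>
  An error that is multiplied by \<open>j\<close> after \<open>j\<close> periods and yet stays bounded is zero.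
\<close>

lemma line_of_sight_slope:
  assumes sight: "line_of_sight \<alpha> \<beta> (infinite_hallway d)"
    and period: "\<And>i. d (i + m) = d i + k"
  shows "\<alpha> * real m = of_int k"
proof (rule ccontr)
  assume "\<alpha> * real m \<noteq> of_int k"
  then have pos: "0 < \<bar>\<alpha> * real m - of_int k\<bar>" by simp
  obtain b where b: "\<And>i. (\<alpha> * real i + \<beta>, b) \<in> doorway (d i)"
    using sight by (auto simp: line_of_sight_iff)
  have close: "of_int (d i) \<le> \<alpha> * real i + \<beta>" "\<alpha> * real i + \<beta> \<le> of_int (d i) + 1" for i
    using b[of i] by (auto simp: mem_doorway_iff)
  have d_mult: "d (j * m) = d 0 + int j * k" for j
  proof (induction j)
    case (Suc j)
    then show ?case using period[of "j * m"] by (simp add: algebra_simps)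
  qed simp
  have bounded: "real j * \<bar>\<alpha> * real m - of_int k\<bar> \<le> 1" for j
  proof -
    have "real j * (\<alpha> * real m - of_int k) =
        (\<alpha> * real (j * m) + \<beta> - of_int (d (j * m))) - (\<alpha> * real 0 + \<beta> - of_int (d 0))"
      by (simp add: d_mult algebra_simps)
    then have "\<bar>real j * (\<alpha> * real m - of_int k)\<bar> \<le> 1"
      using close[of "j * m"] close[of 0] by linarith
    then show ?thesis by (simp add: abs_mult)
  qed
  obtain j where "1 < real j * \<bar>\<alpha> * real m - of_int k\<bar>"
    using reals_Archimedean3[OF pos] by blast
  with bounded[of j] show False by simp
qed

lemma line_of_sight_imp_period:
  assumes sight: "line_of_sight \<alpha> \<beta> (infinite_hallway d)"
    and slope: "\<alpha> * real m = of_int p"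
  shows "d (i + m) = d i + p"
proof -
  obtain b where b: "\<And>i. (\<alpha> * real i + \<beta>, b) \<in> doorway (d i)"
    using sight by (auto simp: line_of_sight_iff)
  have "(\<alpha> * real (i + m) + \<beta>, b) = (\<alpha> * real i + \<beta>, b) + std (of_int p)"
    by (simp add: std_def slope distrib_left)
  also have "\<dots> \<in> doorway (d i + p)"
    using b[of i] by (simp flip: doorway_translate)
  finally show ?thesis using b doorway_unique by blast
qed

theorem theorem30:
  fixes d :: "nat \<Rightarrow> int" and m :: nat
  assumes "\<exists>\<alpha> \<beta>. line_of_sight \<alpha> \<beta> (infinite_hallway d)"
    and "m > 0"
  shows "has_period d m \<longleftrightarrow>
    (\<exists>(p::int) \<beta>. rational_line_of_sight (of_int p / of_nat m) \<beta> (infinite_hallway d))"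
proof
  assume "has_period d m"
  then obtain k where k: "\<And>i. d (i + m) = d i + k" by (auto simp: has_period_iff)
  from assms(1) obtain \<alpha> \<beta> where sight: "line_of_sight \<alpha> \<beta> (infinite_hallway d)" by blast
  have "\<alpha> = of_int k / of_nat m"
    using line_of_sight_slope[OF sight k] \<open>m > 0\<close> by (simp add: field_simps)
  with sight show "\<exists>(p::int) \<beta>. rational_line_of_sight (of_int p / of_nat m) \<beta> (infinite_hallway d)"
    by (auto simp: rational_line_of_sight_def)
next
  assume "\<exists>(p::int) \<beta>. rational_line_of_sight (of_int p / of_nat m) \<beta> (infinite_hallway d)"
  then obtain p :: int and \<beta> where
    sight: "line_of_sight (of_int p / of_nat m) \<beta> (infinite_hallway d)"
    by (auto simp: rational_line_of_sight_def)
  have "\<forall>i. d (i + m) = d i + p"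
    using line_of_sight_imp_period[OF sight] \<open>m > 0\<close> by simp
  with \<open>m > 0\<close> show "has_period d m" by (auto simp: has_period_iff)
qed

end
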